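(* Let $\mathfrak g$ be a finite dimensional simple Lie algebra over $\mathbb C$ with Cartan subalgebra $\mathfrak h$, let $\tau$ be a Chevalley automorphism of $\mathfrak g$, and let $\mathcal A$ be a quantum torus based on a free abelian group $\Lambda$ of finite rank. Then $\bar\tau:=\bar\tau_{\mathrm{id}}$, i.e. the map $$x\otimes a^\lambda+\gamma+d\mapsto\tau(x)\otimes a^{-\lambda}-\gamma-d\qquad(x\in\mathfrak g,\ \lambda\in\Lambda,\ \gamma\in\mathcal V,\ d\in\mathcal V^\star),$$ is a Chevalley automorphism of $\hat L(\mathfrak g,\mathcal A)$. In particular, if $\mathcal A$ is the algebra of Laurent polynomials in $\nu$ variables, then $\bar\tau$ is a Chevalley automorphism of the toroidal Lie algebra $\hat L(\mathfrak g,\mathcal A)$.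
   Context: All algebras are over $\mathbb C$. $\mathfrak g$ is equipped with a non-degenerate invariant symmetric bilinear form $(\cdot,\cdot)$ (a non-zero multiple of the Killing form). Quantum torus: $\mathcal A=\bigoplus_{\lambda\in\Lambda}\mathbb C a^\lambda$, $a^\lambda a^\gamma=\mu(\lambda,\gamma)a^{\lambda+\gamma}$ with $\mu:\Lambda\times\Lambda\to\mathbb C^\times$ a 2-cocycle satisfying $\mu(\lambda,\tau)=\mu(\tau,\lambda)=\mu(-\lambda,-\tau)$ and $\mu(0,0)=1$; form $\epsilon(a^\lambda,a^\tau)=\mu(\lambda,\tau)\delta_{\lambda,-\tau}$. (Laurent polynomials: $\Lambda=\mathbb Z^\nu$, $\mu\equiv1$.) $\mathfrak g\otimes\mathcal A$ has bracket $[x\otimes a,y\otimes b]=[x,y]\otimes ab$ and form $(x\otimes a,y\otimes b)=(x,y)\epsilon(a,b)$. Let $\mathcal V=\mathbb C\otimes_{\mathbb Z}\Lambda\supseteq\Lambda$. $\hat L(\mathfrak g,\mathcal A)=(\mathfrak g\otimes\mathcal A)\oplus\mathcal V\oplus\mathcal V^\star$ with bracket: $[d,x]=d(\lambda)x$ for $d\in\mathcal V^\star$, $x\in\mathfrak g\otimes\mathbb Ca^\lambda$; $\mathcal V$ central; $[\mathcal V^\star,\mathcal V^\star]=0$; $[x,y]=[x,y]_{\mathfrak g\otimes\mathcal A}+(x,y)\lambda$ for $x\in\mathfrak g\otimes\mathbb Ca^\lambda$, $y\in\mathfrak g\otimes\mathcal A$. Its distinguished Cartan subalgebra is $\hat{\mathfrak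 h}=(\mathfrak h\otimes1)\oplus\mathcal V\oplus\mathcal V^\star$. A Chevalley automorphism of a Lie algebra with distinguished Cartan subalgebra $\mathfrak h$ (resp. $\hat{\mathfrak h}$) is an automorphism of finite order acting as $-\mathrm{id}$ on that Cartan subalgebra. *)

theory Defs
  imports
    "HOL-Library.Poly_Mapping"
    "HOL-Library.Product_Plus"
    "HOL-Analysis.Finite_Cartesian_Product"
    "HOL-Algebra.Free_Abelian_Groups"
begin

section \<open>Complex Lie algebras\<close>

locale lie_algebra = vector_space smul
  for smul :: "complex \<Rightarrow> 'g::ab_group_add \<Rightarrow> 'g" +
  fixes bracket :: "'g \<Rightarrow> 'g \<Rightarrow> 'g"
  assumes bracket_add_left: "bracket (x + y) z = bracket x z + bracket y z"
    and bracket_add_right: "bracket x (y + z) = bracket x y + bracket x z"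
    and bracket_scale_left: "bracket (smul c x) y = smul c (bracket x y)"
    and bracket_scale_right: "bracket x (smul c y) = smul c (bracket x y)"
    and bracket_self: "bracket x x = 0"
    and jacobi: "bracket x (bracket y z) + bracket y (bracket z x) + bracket z (bracket x y) = 0"
begin

definition subalgebra :: "'g set \<Rightarrow> bool" where
  "subalgebra H \<longleftrightarrow> subspace H \<and> (\<forall>x\<in>H. \<forall>y\<in>H. bracket x y \<in> H)"

definition lie_ideal :: "'g set \<Rightarrow> bool" where
  "lie_ideal I \<longleftrightarrow> subspace I \<and> (\<forall>x. \<forall>y\<in>I. bracket x y \<in> I)"

fun lower_central_series :: "'g set \<Rightarrow> nat \<Rightarrow> 'g set" where
  "lower_central_series H 0 = H"
| "lower_central_series H (Suc n) =
     span {bracket x y | x y. x \<in> H \<and> y \<in> lower_central_series H n}"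

definition normalizer :: "'g set \<Rightarrow> 'g set" where
  "normalizer H = {x. \<forall>y\<in>H. bracket x y \<in> H}"

definition cartan_subalgebra :: "'g set \<Rightarrow> bool" where
  "cartan_subalgebra H \<longleftrightarrow>
     subalgebra H \<and> (\<exists>n. lower_central_series H n = {0}) \<and> normalizer H = H"

text \<open>The trace is meaningful for linear endomorphisms of a finite-dimensional space, where it
  does not depend on the chosen basis.\<close>

definition trace :: "('g \<Rightarrow> 'g) \<Rightarrow> complex" where
  "trace f = (let B = (SOME B. independent B \<and> span B = UNIV)
              in \<Sum>b\<in>B. representation B (f b) b)"

definition killing_form :: "'g \<Rightarrow> 'g \<Rightarrow> complex" where
  "killing_form x y = trace (\<lambda>z. bracket x (bracket y z))"

definition nondegenerate_invariant_form :: "('g \<Rightarrow> 'g \<Rightarrow> complex) \<Rightarrow> bool" where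
  "nondegenerate_invariant_form form \<longleftrightarrow>
     (\<forall>x. Vector_Spaces.linear smul (*) (form x)) \<and>
     (\<forall>y. Vector_Spaces.linear smul (*) (\<lambda>x. form x y)) \<and>
     (\<forall>x y. form x y = form y x) \<and>
     (\<forall>x y z. form (bracket x y) z = form x (bracket y z)) \<and>
     (\<forall>x. (\<forall>y. form x y = 0) \<longrightarrow> x = 0)"

end

locale simple_lie_algebra = lie_algebra smul bracket
  for smul :: "complex \<Rightarrow> 'g::ab_group_add \<Rightarrow> 'g" and bracket +
  assumes finite_dimensional: "\<exists>B. finite B \<and> span B = UNIV"
    and nonabelian: "\<exists>x y. bracket x y \<noteq> 0"
    and ideals_trivial: "lie_ideal I \<Longrightarrow> I = {0} \<or> I = UNIV"

definition lie_automorphism ::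
  "(complex \<Rightarrow> 'g::ab_group_add \<Rightarrow> 'g) \<Rightarrow> ('g \<Rightarrow> 'g \<Rightarrow> 'g) \<Rightarrow> ('g \<Rightarrow> 'g) \<Rightarrow> bool" where
  "lie_automorphism smul bracket f \<longleftrightarrow>
     lie_algebra smul bracket \<and> Vector_Spaces.linear smul smul f \<and> bij f \<and>
     (\<forall>x y. f (bracket x y) = bracket (f x) (f y))"

definition chevalley_automorphism ::
  "(complex \<Rightarrow> 'g::ab_group_add \<Rightarrow> 'g) \<Rightarrow> ('g \<Rightarrow> 'g \<Rightarrow> 'g) \<Rightarrow> 'g set \<Rightarrow> ('g \<Rightarrow> 'g) \<Rightarrow> bool" where
  "chevalley_automorphism smul bracket H f \<longleftrightarrow>
     lie_automorphism smul bracket f \<and> (\<exists>n>0. f ^^ n = id) \<and> (\<forall>x\<in>H. f x = - x)"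


section \<open>Quantum tori\<close>

definition free_abelian_finite_rank :: "'l::ab_group_add itself \<Rightarrow> bool" where
  "free_abelian_finite_rank (_ :: 'l itself) \<longleftrightarrow>
     (\<exists>n::nat. \<lparr>carrier = (UNIV :: 'l set), monoid.mult = (+), one = 0\<rparr>
                 \<cong> free_Abelian_group {..<n})"

locale quantum_torus =
  fixes \<mu> :: "'l::ab_group_add \<Rightarrow> 'l \<Rightarrow> complex"
  assumes free: "free_abelian_finite_rank TYPE('l)"
    and nonzero: "\<mu> \<alpha> \<gamma> \<noteq> 0"
    and cocycle: "\<mu> \<alpha> \<gamma> * \<mu> (\<alpha> + \<gamma>) \<delta> = \<mu> \<gamma> \<delta> * \<mu> \<alpha> (\<gamma> + \<delta>)"
    and sym: "\<mu> \<alpha> \<gamma> = \<mu> \<gamma> \<alpha>"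
    and uminus: "\<mu> \<alpha> \<gamma> = \<mu> (- \<alpha>) (- \<gamma>)"
    and normalized: "\<mu> 0 0 = 1"

text \<open>The quantum torus is the space of finitely supported functions on \<open>\<Lambda>\<close>, with basis
  \<^term>\<open>torus_basis \<alpha>\<close> in the role of \<open>a\<^sup>\<alpha>\<close>; its unit is \<^term>\<open>torus_basis 0\<close>
  because \<open>\<mu> 0 0 = 1\<close>.\<close>

definition torus_basis :: "'l \<Rightarrow> ('l \<Rightarrow>\<^sub>0 complex)" where
  "torus_basis \<alpha> = Poly_Mapping.single \<alpha> 1"

definition torus_mult ::
  "('l::ab_group_add \<Rightarrow> 'l \<Rightarrow> complex) \<Rightarrow> ('l \<Rightarrow>\<^sub>0 complex) \<Rightarrow> ('l \<Rightarrow>\<^sub>0 complex) \<Rightarrow> ('l \<Rightarrow>\<^sub>0 complex)" where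
  "torus_mult \<mu> a b = (\<Sum>\<alpha>\<in>Poly_Mapping.keys a. \<Sum>\<gamma>\<in>Poly_Mapping.keys b.
     Poly_Mapping.single (\<alpha> + \<gamma>) (Poly_Mapping.lookup a \<alpha> * Poly_Mapping.lookup b \<gamma> * \<mu> \<alpha> \<gamma>))"

definition torus_form ::
  "('l::ab_group_add \<Rightarrow> 'l \<Rightarrow> complex) \<Rightarrow> ('l \<Rightarrow>\<^sub>0 complex) \<Rightarrow> ('l \<Rightarrow>\<^sub>0 complex) \<Rightarrow> complex" where
  "torus_form \<mu> a b = (\<Sum>\<alpha>\<in>Poly_Mapping.keys a. \<Sum>\<gamma>\<in>Poly_Mapping.keys b.
     Poly_Mapping.lookup a \<alpha> * Poly_Mapping.lookup b \<gamma> * (if \<alpha> = - \<gamma> then \<mu> \<alpha> \<gamma> else 0))"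

definition laurent_cocycle :: "int ^ 'n \<Rightarrow> int ^ 'n \<Rightarrow> complex" where
  "laurent_cocycle \<alpha> \<gamma> = 1"


section \<open>The tensor product of a Lie algebra and a quantum torus\<close>

text \<open>As \<open>\<A>\<close> has basis \<open>a\<^sup>\<alpha>\<close>, the tensor product \<open>\<g> \<otimes> \<A>\<close> is the direct sum of the spaces
  \<open>\<g> \<otimes> a\<^sup>\<alpha>\<close>: the finitely supported function \<open>u\<close> stands for the sum of all \<open>u \<alpha> \<otimes> a\<^sup>\<alpha>\<close>.
  Bracket and form are the bilinear extensions of their values at \<open>x \<otimes> a\<^sup>\<alpha>\<close>,
  \<open>y \<otimes> a\<^sup>\<gamma>\<close>; the lemmas \<open>loop_bracket_tensor\<close> and \<open>loop_form_tensor\<close> below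
  give their values on all pure tensors.\<close>

definition tensor ::
  "(complex \<Rightarrow> 'g::ab_group_add \<Rightarrow> 'g) \<Rightarrow> 'g \<Rightarrow> ('l \<Rightarrow>\<^sub>0 complex) \<Rightarrow> ('l \<Rightarrow>\<^sub>0 'g)" where
  "tensor smul x a = (\<Sum>\<alpha>\<in>Poly_Mapping.keys a. Poly_Mapping.single \<alpha> (smul (Poly_Mapping.lookup a \<alpha>) x))"

definition loop_bracket ::
  "(complex \<Rightarrow> 'g::ab_group_add \<Rightarrow> 'g) \<Rightarrow> ('g \<Rightarrow> 'g \<Rightarrow> 'g) \<Rightarrow> ('l::ab_group_add \<Rightarrow> 'l \<Rightarrow> complex) \<Rightarrow>
     ('l \<Rightarrow>\<^sub>0 'g) \<Rightarrow> ('l \<Rightarrow>\<^sub>0 'g) \<Rightarrow> ('l \<Rightarrow>\<^sub>0 'g)" where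
  "loop_bracket smul bracket \<mu> u v = (\<Sum>\<alpha>\<in>Poly_Mapping.keys u. \<Sum>\<gamma>\<in>Poly_Mapping.keys v.
     tensor smul (bracket (Poly_Mapping.lookup u \<alpha>) (Poly_Mapping.lookup v \<gamma>))
       (torus_mult \<mu> (torus_basis \<alpha>) (torus_basis \<gamma>)))"

definition loop_form ::
  "('g::ab_group_add \<Rightarrow> 'g \<Rightarrow> complex) \<Rightarrow> ('l::ab_group_add \<Rightarrow> 'l \<Rightarrow> complex) \<Rightarrow>
     ('l \<Rightarrow>\<^sub>0 'g) \<Rightarrow> ('l \<Rightarrow>\<^sub>0 'g) \<Rightarrow> complex" where
  "loop_form form \<mu> u v = (\<Sum>\<alpha>\<in>Poly_Mapping.keys u. \<Sum>\<gamma>\<in>Poly_Mapping.keys v.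
     form (Poly_Mapping.lookup u \<alpha>) (Poly_Mapping.lookup v \<gamma>) * torus_form \<mu> (torus_basis \<alpha>) (torus_basis \<gamma>))"

lemma (in lie_algebra) lookup_tensor: "Poly_Mapping.lookup (tensor smul x a) \<alpha> = smul (Poly_Mapping.lookup a \<alpha>) x"
proof -
  have "Poly_Mapping.lookup (tensor smul x a) \<alpha> = (\<Sum>\<gamma>\<in>Poly_Mapping.keys a. if \<gamma> = \<alpha> then smul (Poly_Mapping.lookup a \<alpha>) x else 0)"
    unfolding tensor_def lookup_sum lookup_single by (intro sum.cong) (auto simp: when_def)
  also have "\<dots> = smul (Poly_Mapping.lookup a \<alpha>) x"
    by (subst sum.delta) (auto simp: in_keys_iff)
  finally show ?thesis .
qed

lemma (in lie_algebra) tensor_add: "tensor smul x (a + b) = tensor smul x a + tensor smul x b"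
  by (rule poly_mapping_eqI) (simp add: lookup_tensor lookup_add scale_left_distrib)

lemma (in lie_algebra) tensor_sum: "tensor smul x (sum f A) = (\<Sum>i\<in>A. tensor smul x (f i))"
proof (induction A rule: infinite_finite_induct)
  case (insert i A)
  then show ?case by (simp add: tensor_add)
qed (auto simp: tensor_def)

lemma (in lie_algebra) tensor_single:
  "tensor smul x (Poly_Mapping.single \<alpha> c) = Poly_Mapping.single \<alpha> (smul c x)"
  by (rule poly_mapping_eqI) (simp add: lookup_tensor lookup_single when_def)

lemma torus_mult_basis:
  "torus_mult \<mu> (torus_basis \<alpha>) (torus_basis \<gamma>) = Poly_Mapping.single (\<alpha> + \<gamma>) (\<mu> \<alpha> \<gamma>)"
  by (simp add: torus_mult_def torus_basis_def)

lemma torus_form_basis: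
  "torus_form \<mu> (torus_basis \<alpha>) (torus_basis \<gamma>) = (if \<alpha> = - \<gamma> then \<mu> \<alpha> \<gamma> else 0)"
  by (simp add: torus_form_def torus_basis_def)

lemma (in lie_algebra) bracket_0: "bracket 0 x = 0" "bracket x 0 = 0"
  using bracket_scale_left[of 0 0 x] bracket_scale_right[of x 0 0] by simp_all

lemma (in lie_algebra) loop_bracket_tensor:
  "loop_bracket smul bracket \<mu> (tensor smul x a) (tensor smul y b)
     = tensor smul (bracket x y) (torus_mult \<mu> a b)"
proof -
  have k: "Poly_Mapping.keys (tensor smul z c) \<subseteq> Poly_Mapping.keys c" for z and c :: "'a \<Rightarrow>\<^sub>0 complex"
    by (auto simp: in_keys_iff lookup_tensor)
  have "loop_bracket smul bracket \<mu> (tensor smul x a) (tensor smul y b)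
      = (\<Sum>\<alpha>\<in>Poly_Mapping.keys (tensor smul x a). \<Sum>\<gamma>\<in>Poly_Mapping.keys (tensor smul y b).
          Poly_Mapping.single (\<alpha> + \<gamma>)
            (smul (Poly_Mapping.lookup a \<alpha> * Poly_Mapping.lookup b \<gamma> * \<mu> \<alpha> \<gamma>) (bracket x y)))"
    by (simp add: loop_bracket_def torus_mult_basis tensor_single lookup_tensor
        bracket_scale_left bracket_scale_right mult_ac)
  also have "\<dots> = (\<Sum>\<alpha>\<in>Poly_Mapping.keys a. \<Sum>\<gamma>\<in>Poly_Mapping.keys (tensor smul y b).
          Poly_Mapping.single (\<alpha> + \<gamma>)
            (smul (Poly_Mapping.lookup a \<alpha> * Poly_Mapping.lookup b \<gamma> * \<mu> \<alpha> \<gamma>) (bracket x y)))"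
    by (rule sum.mono_neutral_left)
      (use k[of x a] in \<open>auto simp: in_keys_iff lookup_tensor bracket_0\<close>)
  also have "\<dots> = (\<Sum>\<alpha>\<in>Poly_Mapping.keys a. \<Sum>\<gamma>\<in>Poly_Mapping.keys b. Poly_Mapping.single (\<alpha> + \<gamma>)
            (smul (Poly_Mapping.lookup a \<alpha> * Poly_Mapping.lookup b \<gamma> * \<mu> \<alpha> \<gamma>) (bracket x y)))"
    by (intro sum.cong refl sum.mono_neutral_left)
      (use k[of y b] in \<open>auto simp: in_keys_iff lookup_tensor bracket_0\<close>)
  also have "\<dots> = tensor smul (bracket x y) (torus_mult \<mu> a b)"
    by (simp add: torus_mult_def tensor_sum tensor_single)
  finally show ?thesis .
qed

lemma (in lie_algebra) loop_form_tensor: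
  assumes "nondegenerate_invariant_form form"
  shows "loop_form form \<mu> (tensor smul x a) (tensor smul y b) = form x y * torus_form \<mu> a b"
proof -
  have k: "Poly_Mapping.keys (tensor smul z c) \<subseteq> Poly_Mapping.keys c" for z and c :: "'a \<Rightarrow>\<^sub>0 complex"
    by (auto simp: in_keys_iff lookup_tensor)
  have r: "form u (smul c v) = c * form u v" for c u v
    using assms unfolding nondegenerate_invariant_form_def Vector_Spaces.linear_def
    by (blast intro: module_hom.scale)
  then have l: "form (smul c u) v = c * form u v" for c u v
    using assms unfolding nondegenerate_invariant_form_def by metis
  have z: "form u 0 = 0" "form 0 u = 0" for u
    using r[of u 0 0] l[of 0 0 u] by simp_all
  let ?t = "\<lambda>\<alpha> \<gamma>. form x y * (Poly_Mapping.lookup a \<alpha> * Poly_Mapping.lookup b \<gamma> * (if \<alpha> = - \<gamma> then \<mu> \<alpha> \<gamma> else 0))"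
  have "loop_form form \<mu> (tensor smul x a) (tensor smul y b)
      = (\<Sum>\<alpha>\<in>Poly_Mapping.keys (tensor smul x a). \<Sum>\<gamma>\<in>Poly_Mapping.keys (tensor smul y b). ?t \<alpha> \<gamma>)"
    unfolding loop_form_def torus_form_basis lookup_tensor
    by (intro sum.cong refl) (simp add: l r mult_ac)
  also have "\<dots> = (\<Sum>\<alpha>\<in>Poly_Mapping.keys a. \<Sum>\<gamma>\<in>Poly_Mapping.keys (tensor smul y b). ?t \<alpha> \<gamma>)"
    by (rule sum.mono_neutral_left)
      (use k[of x a] in \<open>auto simp: in_keys_iff lookup_tensor z\<close>)
  also have "\<dots> = (\<Sum>\<alpha>\<in>Poly_Mapping.keys a. \<Sum>\<gamma>\<in>Poly_Mapping.keys b. ?t \<alpha> \<gamma>)"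
    by (intro sum.cong refl sum.mono_neutral_left)
      (use k[of y b] in \<open>auto simp: in_keys_iff lookup_tensor z\<close>)
  also have "\<dots> = form x y * torus_form \<mu> a b"
    by (simp add: torus_form_def sum_distrib_left)
  finally show ?thesis .
qed


section \<open>The space \<open>\<V> = \<complex> \<otimes>\<^sub>\<int> \<Lambda>\<close> and its dual\<close>

text \<open>The tensor product over the integers: the free abelian group on \<open>\<complex> \<times> \<Lambda>\<close> modulo the
  subgroup generated by the biadditivity relations.\<close>

inductive_set tensor_relations :: "((complex \<times> 'l::ab_group_add) \<Rightarrow>\<^sub>0 int) set" where
  zero: "0 \<in> tensor_relations"
| add_left: "frag_of (c + c', \<alpha>) - frag_of (c, \<alpha>) - frag_of (c', \<alpha>) \<in> tensor_relations"
| add_right: "frag_of (c, \<alpha> + \<alpha>') - frag_of (c, \<alpha>) - frag_of (c, \<alpha>') \<in> tensor_relations"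
| diff: "p \<in> tensor_relations \<Longrightarrow> q \<in> tensor_relations \<Longrightarrow> p - q \<in> tensor_relations"

lemma tensor_relations_uminus: "p \<in> tensor_relations \<Longrightarrow> - p \<in> tensor_relations"
  using tensor_relations.diff[OF tensor_relations.zero] by fastforce

lemma tensor_relations_add:
  "p \<in> tensor_relations \<Longrightarrow> q \<in> tensor_relations \<Longrightarrow> p + q \<in> tensor_relations"
  using tensor_relations.diff[OF _ tensor_relations_uminus] by fastforce

quotient_type (overloaded) 'l complexification =
  "(complex \<times> 'l::ab_group_add) \<Rightarrow>\<^sub>0 int" / "\<lambda>p q. p - q \<in> tensor_relations"
proof (rule equivpI)
  show "reflp (\<lambda>p q. p - q \<in> tensor_relations)"
    by (simp add: reflp_def tensor_relations.zero)
  show "symp (\<lambda>p q. p - q \<in> tensor_relations)"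
    by (auto simp: symp_def dest: tensor_relations_uminus)
  show "transp (\<lambda>p q. p - q \<in> tensor_relations)"
    by (auto simp: transp_def dest: tensor_relations_add)
qed

instantiation complexification :: (ab_group_add) ab_group_add
begin

lift_definition zero_complexification :: "'a complexification" is 0 .

lift_definition plus_complexification ::
  "'a complexification \<Rightarrow> 'a complexification \<Rightarrow> 'a complexification" is "(+)"
  by (drule (1) tensor_relations_add) (simp add: algebra_simps)

lift_definition uminus_complexification :: "'a complexification \<Rightarrow> 'a complexification" is uminus
  by (drule tensor_relations_uminus) simp

lift_definition minus_complexification ::
  "'a complexification \<Rightarrow> 'a complexification \<Rightarrow> 'a complexification" is "(-)"
  by (drule (1) tensor_relations.diff) (simp add: algebra_simps)

instance
  by standard (transfer; simp add: algebra_simps tensor_relations.zero)+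

end

lift_definition complexification_tensor :: "complex \<Rightarrow> 'l::ab_group_add \<Rightarrow> 'l complexification"
  is "\<lambda>c \<alpha>. frag_of (c, \<alpha>)" .

lift_definition complexification_scale ::
  "complex \<Rightarrow> 'l::ab_group_add complexification \<Rightarrow> 'l complexification"
  is "\<lambda>c. frag_extend (\<lambda>(c', \<alpha>). frag_of (c * c', \<alpha>))"
proof -
  fix c :: complex and p q :: "(complex \<times> 'l) \<Rightarrow>\<^sub>0 int"
  let ?s = "frag_extend (\<lambda>(c', \<alpha>). frag_of (c * c', \<alpha>)) :: _ \<Rightarrow> ((complex \<times> 'l) \<Rightarrow>\<^sub>0 int)"
  have "?s r \<in> tensor_relations" if "r \<in> tensor_relations" for r
    using that
    by induction
      (auto simp: frag_extend_diff distrib_left intro: tensor_relations.intros)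
  then show "?s p - ?s q \<in> tensor_relations" if "p - q \<in> tensor_relations"
    using that by (metis frag_extend_diff)
qed

abbreviation lattice_embedding :: "'l::ab_group_add \<Rightarrow> 'l complexification" where
  "lattice_embedding \<alpha> \<equiv> complexification_tensor 1 \<alpha>"

lemma complexification_scale_tensor:
  "complexification_scale c (complexification_tensor c' \<alpha>) = complexification_tensor (c * c') \<alpha>"
  by transfer (simp add: tensor_relations.zero)

interpretation complexification: vector_space complexification_scale
proof
  fix a b :: complex and x y :: "'l::ab_group_add complexification"
  show "complexification_scale a (x + y) = complexification_scale a x + complexification_scale a y"
    by transfer (simp add: frag_extend_add tensor_relations.zero)
  show "complexification_scale (a + b) x = complexification_scale a x + complexification_scale b x"
  proof transfer
    fix a b :: complex and p :: "(complex \<times> 'l) \<Rightarrow>\<^sub>0 int"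
    let ?s = "\<lambda>c. frag_extend (\<lambda>(c', \<alpha>). frag_of (c * c', \<alpha>)) :: _ \<Rightarrow> ((complex \<times> 'l) \<Rightarrow>\<^sub>0 int)"
    have "Poly_Mapping.keys p \<subseteq> UNIV" by simp
    then show "?s (a + b) p - (?s a p + ?s b p) \<in> tensor_relations"
    proof (induction p rule: frag_induction)
      case zero
      show ?case by (simp add: tensor_relations.zero)
    next
      case (one x)
      show ?case
        using tensor_relations.add_left[of "a * fst x" "b * fst x" "snd x"]
        by (simp add: distrib_right diff_diff_eq case_prod_beta)
    next
      case (diff p q)
      have "?s (a + b) (p - q) - (?s a (p - q) + ?s b (p - q))
          = (?s (a + b) p - (?s a p + ?s b p)) - (?s (a + b) q - (?s a q + ?s b q))"
        by (simp add: frag_extend_diff)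
      with diff show ?case by (metis tensor_relations.diff)
    qed
  qed
  show "complexification_scale a (complexification_scale b x) = complexification_scale (a * b) x"
  proof transfer
    fix a b :: complex and p :: "(complex \<times> 'l) \<Rightarrow>\<^sub>0 int"
    let ?s = "\<lambda>c. frag_extend (\<lambda>(c', \<alpha>). frag_of (c * c', \<alpha>)) :: _ \<Rightarrow> ((complex \<times> 'l) \<Rightarrow>\<^sub>0 int)"
    have "Poly_Mapping.keys p \<subseteq> UNIV" by simp
    then have "?s a (?s b p) = ?s (a * b) p"
      by (induction p rule: frag_induction) (auto simp: frag_extend_diff mult.assoc)
    then show "?s a (?s b p) - ?s (a * b) p \<in> tensor_relations"
      by (simp add: tensor_relations.zero)
  qed
  show "complexification_scale 1 x = x"
  proof transfer
    fix p :: "(complex \<times> 'l) \<Rightarrow>\<^sub>0 int"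
    have "Poly_Mapping.keys p \<subseteq> UNIV" by simp
    then have "frag_extend (\<lambda>(c', \<alpha>). frag_of (1 * c', \<alpha>)) p = p"
      by (induction p rule: frag_induction) (auto simp: frag_extend_diff)
    then show "frag_extend (\<lambda>(c', \<alpha>). frag_of (1 * c', \<alpha>)) p - p \<in> tensor_relations"
      by (simp add: tensor_relations.zero)
  qed
qed

typedef (overloaded) 'l complexification_dual =
  "{d :: 'l::ab_group_add complexification \<Rightarrow> complex.
      Vector_Spaces.linear complexification_scale (*) d}"
  morphisms dual_apply Abs_dual
proof -
  interpret complex: vector_space "(*) :: complex \<Rightarrow> complex \<Rightarrow> complex"
    by unfold_locales (simp_all add: algebra_simps)
  interpret vector_space_pair complexification_scale "(*) :: complex \<Rightarrow> complex \<Rightarrow> complex"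
    by unfold_locales
  show ?thesis using linear_zero by blast
qed

setup_lifting type_definition_complexification_dual

interpretation complexification_pair:
  vector_space_pair complexification_scale "(*) :: complex \<Rightarrow> complex \<Rightarrow> complex"
  by unfold_locales (simp_all add: algebra_simps)

instantiation complexification_dual :: (ab_group_add) ab_group_add
begin

lift_definition zero_complexification_dual :: "'a complexification_dual" is "\<lambda>_. 0"
  by (rule complexification_pair.linear_zero)

lift_definition plus_complexification_dual ::
  "'a complexification_dual \<Rightarrow> 'a complexification_dual \<Rightarrow> 'a complexification_dual"
  is "\<lambda>d e v. d v + e v"
  by (rule complexification_pair.linear_compose_add)

lift_definition uminus_complexification_dual :: "'a complexification_dual \<Rightarrow> 'a complexification_dual"
  is "\<lambda>d v. - d v"
  by (rule complexification_pair.linear_compose_neg)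

lift_definition minus_complexification_dual ::
  "'a complexification_dual \<Rightarrow> 'a complexification_dual \<Rightarrow> 'a complexification_dual"
  is "\<lambda>d e v. d v - e v"
  by (rule complexification_pair.linear_compose_sub)

instance
  by standard (transfer; simp add: algebra_simps)+

end

lift_definition dual_scale ::
  "complex \<Rightarrow> 'l::ab_group_add complexification_dual \<Rightarrow> 'l complexification_dual"
  is "\<lambda>c d v. c * d v"
  by (rule complexification_pair.linear_compose_scale_right)


section \<open>The Lie algebra \<open>L\<close>-hat and the map \<open>\<tau>\<close>-bar\<close>

text \<open>The triple \<open>(u, \<gamma>, d)\<close> stands for \<open>u + \<gamma> + d\<close> with \<open>u \<in> \<g> \<otimes> \<A>\<close>, \<open>\<gamma> \<in> \<V>\<close>
  and \<open>d \<in> \<V>\<^sup>\<star>\<close>.\<close>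

type_synonym ('g, 'l) lhat = "('l \<Rightarrow>\<^sub>0 'g) \<times> 'l complexification \<times> 'l complexification_dual"

definition lhat_scale ::
  "(complex \<Rightarrow> 'g::ab_group_add \<Rightarrow> 'g) \<Rightarrow> complex \<Rightarrow> ('g, 'l::ab_group_add) lhat \<Rightarrow> ('g, 'l) lhat" where
  "lhat_scale smul c = (\<lambda>(u, \<gamma>, d).
     (Poly_Mapping.map (smul c) u, complexification_scale c \<gamma>, dual_scale c d))"

text \<open>The degree derivation \<open>[d, \<cdot>]\<close> on \<open>\<g> \<otimes> \<A>\<close>.  The lattice lies in \<open>\<V>\<close> as
  \<open>1 \<otimes> \<alpha>\<close>.\<close>

definition degree_action ::
  "(complex \<Rightarrow> 'g::ab_group_add \<Rightarrow> 'g) \<Rightarrow> 'l::ab_group_add complexification_dual \<Rightarrow>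
     ('l \<Rightarrow>\<^sub>0 'g) \<Rightarrow> ('l \<Rightarrow>\<^sub>0 'g)" where
  "degree_action smul d u = (\<Sum>\<alpha>\<in>Poly_Mapping.keys u.
     Poly_Mapping.single \<alpha> (smul (dual_apply d (lattice_embedding \<alpha>)) (Poly_Mapping.lookup u \<alpha>)))"

definition central_term ::
  "('g::ab_group_add \<Rightarrow> 'g \<Rightarrow> complex) \<Rightarrow> ('l::ab_group_add \<Rightarrow> 'l \<Rightarrow> complex) \<Rightarrow>
     ('l \<Rightarrow>\<^sub>0 'g) \<Rightarrow> ('l \<Rightarrow>\<^sub>0 'g) \<Rightarrow> 'l complexification" where
  "central_term form \<mu> u v = (\<Sum>\<alpha>\<in>Poly_Mapping.keys u. complexification_scale
     (loop_form form \<mu> (Poly_Mapping.single \<alpha> (Poly_Mapping.lookup u \<alpha>)) v) (lattice_embedding \<alpha>))"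

definition lhat_bracket ::
  "(complex \<Rightarrow> 'g::ab_group_add \<Rightarrow> 'g) \<Rightarrow> ('g \<Rightarrow> 'g \<Rightarrow> 'g) \<Rightarrow> ('g \<Rightarrow> 'g \<Rightarrow> complex) \<Rightarrow>
     ('l::ab_group_add \<Rightarrow> 'l \<Rightarrow> complex) \<Rightarrow> ('g, 'l) lhat \<Rightarrow> ('g, 'l) lhat \<Rightarrow> ('g, 'l) lhat" where
  "lhat_bracket smul bracket form \<mu> = (\<lambda>(u, \<gamma>, d) (v, \<delta>, e).
     (loop_bracket smul bracket \<mu> u v + degree_action smul d v - degree_action smul e u,
      central_term form \<mu> u v,
      0))"

definition lhat_cartan ::
  "(complex \<Rightarrow> 'g::ab_group_add \<Rightarrow> 'g) \<Rightarrow> 'g set \<Rightarrow> ('g, 'l::ab_group_add) lhat set" where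
  "lhat_cartan smul H = {(tensor smul x (torus_basis 0), \<gamma>, d) | x \<gamma> d. x \<in> H}"

definition tau_bar ::
  "(complex \<Rightarrow> 'g::ab_group_add \<Rightarrow> 'g) \<Rightarrow> ('g \<Rightarrow> 'g) \<Rightarrow> ('g, 'l::ab_group_add) lhat \<Rightarrow> ('g, 'l) lhat" where
  "tau_bar smul \<tau> = (\<lambda>(u, \<gamma>, d).
     (\<Sum>\<alpha>\<in>Poly_Mapping.keys u. tensor smul (\<tau> (Poly_Mapping.lookup u \<alpha>)) (torus_basis (- \<alpha>)), - \<gamma>, - d))"

lemma (in lie_algebra) tau_bar_tensor:
  assumes "Vector_Spaces.linear smul smul \<tau>"
  shows "tau_bar smul \<tau> (tensor smul x (torus_basis \<alpha>), \<gamma>, d)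
           = (tensor smul (\<tau> x) (torus_basis (- \<alpha>)), - \<gamma>, - d)"
proof -
  interpret \<tau>: Vector_Spaces.linear smul smul \<tau> by fact
  show ?thesis
    by (cases "x = 0") (simp_all add: tau_bar_def torus_basis_def tensor_single \<tau>.zero)
qed

end

theory Submission
  imports Defs
begin

text \<open>The map \<open>\<tau>\<close>-bar reverses the grading by \<open>\<Lambda>\<close> and acts as \<open>\<tau>\<close> on the coefficients.  It respects the
  product of the torus because \<open>\<mu>(\<alpha>, \<gamma>) = \<mu>(-\<alpha>, -\<gamma>)\<close>, and it negates the central cocycle because
  \<open>\<tau>\<close> preserves the form, which is a multiple of the Killing form and hence a trace that is
  invariant under conjugation.  If \<open>\<tau>\<close> has order dividing \<open>n\<close>, then \<open>\<tau>\<close>-bar has order dividing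
  \<open>2 n\<close>.  By biadditivity all identities reduce to homogeneous elements \<open>x \<otimes> a\<^sup>\<alpha>\<close>.\<close>

text \<open>The interpretation \<open>complexification_pair\<close> makes \<open>a * (b * x) = a * b * x\<close> a simplification rule for
  complex numbers; it loops with associativity.\<close>

declare complexification_pair.vs2.scale_scale [simp del]

section \<open>Finitely supported functions\<close>

lemma poly_mapping_add_induct [case_names single add]:
  assumes single: "\<And>k x. P (Poly_Mapping.single k x)"
    and add: "\<And>u v. P u \<Longrightarrow> P v \<Longrightarrow> P (u + v)"
  shows "P (u :: 'a \<Rightarrow>\<^sub>0 'b::ab_group_add)"
proof (induction u rule: Poly_Mapping.update_induct)
  case const
  \<comment> \<open>Zero is homogeneous of any degree, with coefficient 0; hence the rule has no
    separate case for it.\<close>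
  show ?case using single[of undefined 0] by simp
next
  case (update f a b)
  have "Poly_Mapping.update a b f = Poly_Mapping.single a b + f"
    using update(1)
    by (intro poly_mapping_eqI) (auto simp: lookup_add lookup_update lookup_single in_keys_iff)
  then show ?case using add single update by metis
qed

text \<open>Coefficients may cancel in \<open>u + v\<close>, so its keys can be fewer than the union
  of the two key sets. Extending all three sums to that union is harmless because additivity forces
  \<open>F k 0 = 0\<close>.\<close>

lemma sum_keys_add:
  fixes F :: "'l \<Rightarrow> 'a::ab_group_add \<Rightarrow> 'b::ab_group_add"
  assumes "\<And>k x y. F k (x + y) = F k x + F k y"
  shows "(\<Sum>k\<in>Poly_Mapping.keys (u + v). F k (Poly_Mapping.lookup (u + v) k))
    = (\<Sum>k\<in>Poly_Mapping.keys u. F k (Poly_Mapping.lookup u k))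
      + (\<Sum>k\<in>Poly_Mapping.keys v. F k (Poly_Mapping.lookup v k))"
proof -
  have z: "F k 0 = 0" for k
    using assms[of k 0 0] by simp
  let ?K = "Poly_Mapping.keys u \<union> Poly_Mapping.keys v"
  have "(\<Sum>k\<in>Poly_Mapping.keys w. F k (Poly_Mapping.lookup w k)) = (\<Sum>k\<in>?K. F k (Poly_Mapping.lookup w k))"
    if "Poly_Mapping.keys w \<subseteq> ?K" for w
    using that by (intro sum.mono_neutral_left) (auto simp: z in_keys_iff)
  then show ?thesis
    using Poly_Mapping.keys_add[of u v] by (simp only: Un_upper1 Un_upper2) (simp only: lookup_add assms sum.distrib)
qed

lemma sum_keys_single:
  assumes "F k 0 = 0"
  shows "(\<Sum>j\<in>Poly_Mapping.keys (Poly_Mapping.single k x). F j (Poly_Mapping.lookup (Poly_Mapping.single k x) j)) = F k x"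
  using assms by (cases "x = 0") simp_all

section \<open>Invariance of the Killing form\<close>

context vector_space
begin

text \<open>Expanding both composites as matrix products in the basis B gives one double sum, read
  in either order: tr(pq) = tr(qp).\<close>

lemma sum_representation_comp:
  assumes B: "finite B" "independent B" "span B = UNIV"
    and p: "Vector_Spaces.linear scale scale p" and q: "Vector_Spaces.linear scale scale q"
  shows "(\<Sum>b\<in>B. representation B (p (q b)) b) = (\<Sum>b\<in>B. representation B (q (p b)) b)"
proof -
  \<comment> \<open>The matrix of f in the basis B has the coordinates of \<open>f c\<close> as its
    columns.\<close>
  have e: "representation B (f y) b = (\<Sum>c\<in>B. representation B y c * representation B (f c) b)"
    if f: "Vector_Spaces.linear scale scale f" for f y b
  proof -
    interpret f: Vector_Spaces.linear scale scale f by fact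
    have "f y = f (\<Sum>c\<in>B. scale (representation B y c) c)"
      using B by (simp add: sum_representation_eq)
    also have "\<dots> = (\<Sum>c\<in>B. scale (representation B y c) (f c))"
      by (simp add: f.sum f.scale)
    finally show ?thesis
      using B by (simp add: representation_sum representation_scale)
  qed
  have "(\<Sum>b\<in>B. representation B (p (q b)) b)
      = (\<Sum>b\<in>B. \<Sum>c\<in>B. representation B (q b) c * representation B (p c) b)"
    by (intro sum.cong refl e[OF p])
  also have "\<dots> = (\<Sum>c\<in>B. \<Sum>b\<in>B. representation B (p c) b * representation B (q b) c)"
    by (subst sum.swap) (simp add: mult.commute)
  also have "\<dots> = (\<Sum>c\<in>B. representation B (q (p c)) c)"
    by (intro sum.cong refl e[OF q, symmetric])
  finally show ?thesis .
qed

end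

lemma (in simple_lie_algebra) trace_comp:
  assumes "Vector_Spaces.linear smul smul p" and "Vector_Spaces.linear smul smul q"
  shows "trace (\<lambda>x. p (q x)) = trace (\<lambda>x. q (p x))"
proof -
  obtain B where "finite B" "span B = UNIV"
    using finite_dimensional by blast
  \<comment> \<open>C is the unspecified basis inside \<open>trace\<close>. It exists by extending
    to a maximal independent set, and it is finite because an independent set has at most as many
    elements as the finite spanning set B.\<close>
  moreover define C where "C = (SOME B. independent B \<and> span B = UNIV)"
  have "\<exists>B. independent B \<and> span B = UNIV"
    using maximal_independent_subset[of UNIV] by (metis top.extremum_uniqueI)
  then have "independent C" "span C = UNIV"
    unfolding C_def by (metis (mono_tags, lifting) someI_ex)+
  ultimately have "finite C"
    using independent_span_bound[of B C] by simp
  then show ?thesis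
    using \<open>independent C\<close> \<open>span C = UNIV\<close> assms
    unfolding trace_def Let_def C_def[symmetric] by (intro sum_representation_comp) auto
qed

text \<open>For an automorphism, ad (f x) is the conjugate of ad x by f, so the trace that defines
  the Killing form is unchanged by cyclicity.\<close>

lemma (in simple_lie_algebra) killing_form_automorphism:
  assumes "lie_automorphism smul bracket f"
  shows "killing_form (f x) (f y) = killing_form x y"
proof -
  have lin: "Vector_Spaces.linear smul smul f" and "bij f"
    and br: "\<And>x y. f (bracket x y) = bracket (f x) (f y)"
    using assms by (auto simp: lie_automorphism_def)
  interpret f: vector_space_pair smul smul ..
  obtain g where "Vector_Spaces.linear smul smul g" "g \<circ> f = id"
    using f.linear_injective_left_inverse[OF lin bij_is_inj[OF \<open>bij f\<close>]] by blast
  moreover from this \<open>bij f\<close> have g: "f (g z) = z" "g (f z) = z" for z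
    by (metis comp_apply id_apply bij_pointE, metis comp_apply id_apply)
  ultimately have q: "Vector_Spaces.linear smul smul (\<lambda>z. bracket x (bracket y (g z)))"
    by (auto simp: Vector_Spaces.linear_iff bracket_add_right bracket_scale_right)
  \<comment> \<open>On the right, \<open>br\<close> moves f inward past both brackets until it meets
    g and cancels.\<close>
  have "killing_form (f x) (f y) = trace (\<lambda>z. f (bracket x (bracket y (g z))))"
    by (simp add: killing_form_def br g)
  also have "\<dots> = trace (\<lambda>z. bracket x (bracket y (g (f z))))"
    by (rule trace_comp[OF lin q])
  finally show ?thesis
    by (simp add: killing_form_def g)
qed

section \<open>The toroidal bracket\<close>

lemma complexification_tensor_add:
  "complexification_tensor c (\<alpha> + \<gamma>) = complexification_tensor c \<alpha> + complexification_tensor c \<gamma>"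
  using tensor_relations.add_right[of c \<alpha> \<gamma>] by transfer (simp add: diff_diff_eq)

lemma complexification_tensor_0: "complexification_tensor c 0 = 0"
  using complexification_tensor_add[of c 0 0] by simp

lemma complexification_tensor_uminus: "complexification_tensor c (- \<alpha>) = - complexification_tensor c \<alpha>"
  using complexification_tensor_add[of c \<alpha> "- \<alpha>"]
  by (simp add: complexification_tensor_0 eq_neg_iff_add_eq_0 add.commute)

lemma dual_apply_add: "dual_apply d (v + w) = dual_apply d v + dual_apply d w"
  using dual_apply[of d] by (simp add: Vector_Spaces.linear_iff)

lemma dual_apply_uminus: "dual_apply d (- v) = - dual_apply d v"
  using dual_apply_add[of d v "- v"] dual_apply_add[of d 0 0]
  by (simp add: eq_neg_iff_add_eq_0 add.commute)

lemma dual_scale_simps: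
  fixes d e :: "'l::ab_group_add complexification_dual"
  shows "dual_scale a (d + e) = dual_scale a d + dual_scale a e"
    and "dual_scale (a + b) d = dual_scale a d + dual_scale b d"
    and "dual_scale a (dual_scale b d) = dual_scale (a * b) d"
    and "dual_scale 1 d = d"
    and "dual_scale a 0 = 0"
    and "dual_scale a (- d) = - dual_scale a d"
  unfolding dual_apply_inject[symmetric] fun_eq_iff dual_scale.rep_eq zero_complexification_dual.rep_eq
    plus_complexification_dual.rep_eq uminus_complexification_dual.rep_eq
  by (simp_all add: distrib_left distrib_right)

text \<open>Bundles the data from which the bracket is built, so that a general quantum torus and
  the Laurent polynomials are two instances of the same results.\<close>

locale affinization = lie_algebra smul bracket
  for smul :: "complex \<Rightarrow> 'g::ab_group_add \<Rightarrow> 'g" and bracket +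
  fixes form :: "'g \<Rightarrow> 'g \<Rightarrow> complex" and \<mu> :: "'l::ab_group_add \<Rightarrow> 'l \<Rightarrow> complex"
  assumes form: "nondegenerate_invariant_form form"
    and cocycle: "\<mu> \<alpha> \<gamma> * \<mu> (\<alpha> + \<gamma>) \<delta> = \<mu> \<gamma> \<delta> * \<mu> \<alpha> (\<gamma> + \<delta>)"
    and sym: "\<mu> \<alpha> \<gamma> = \<mu> \<gamma> \<alpha>"
    and uminus: "\<mu> \<alpha> \<gamma> = \<mu> (- \<alpha>) (- \<gamma>)"
begin

abbreviation "loop_scale c \<equiv> Poly_Mapping.map (smul c)"
abbreviation "loop_br \<equiv> loop_bracket smul bracket \<mu>"
abbreviation "deg \<equiv> degree_action smul"
abbreviation "central \<equiv> central_term form \<mu>"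

section \<open>Biadditivity and values on homogeneous elements\<close>

lemma form_linear:
  "form (x + x') y = form x y + form x' y" "form x (y + y') = form x y + form x y'"
  "form (smul c x) y = c * form x y" "form x (smul c y) = c * form x y"
  using form unfolding nondegenerate_invariant_form_def Vector_Spaces.linear_iff by blast+

lemma form_0 [simp]: "form 0 y = 0" "form x 0 = 0"
  using form_linear(3)[of 0 0 y] form_linear(4)[of x 0 0] by simp_all

lemma form_commute: "form x y = form y x"
  and form_bracket: "form (bracket x y) z = form x (bracket y z)"
  using form unfolding nondegenerate_invariant_form_def by blast+

lemma bracket_skew: "bracket y x = - bracket x y"
proof -
  have "bracket x y + bracket y x = bracket (x + y) (x + y)"
    unfolding bracket_add_left bracket_add_right by (simp add: bracket_self)
  then show ?thesis
    by (simp add: bracket_self eq_neg_iff_add_eq_0 add.commute)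
qed

lemma lookup_loop_scale [simp]: "Poly_Mapping.lookup (loop_scale c u) \<alpha> = smul c (Poly_Mapping.lookup u \<alpha>)"
  by (simp add: Poly_Mapping.map.rep_eq when_def)

lemma loop_scale_add: "loop_scale c (u + v) = loop_scale c u + loop_scale c v"
  by (rule poly_mapping_eqI) (simp add: lookup_add scale_right_distrib)

lemma loop_scale_single: "loop_scale c (Poly_Mapping.single \<alpha> x) = Poly_Mapping.single \<alpha> (smul c x)"
  by (rule poly_mapping_eqI) (simp add: lookup_single when_def)

text \<open>Brings the double sum into the shape \<open>F k (lookup u k)\<close> with F additive, to
  which \<open>sum_keys_add\<close> applies in either argument.\<close>

lemma loop_bracket_eq:
  "loop_br u v = (\<Sum>\<alpha>\<in>Poly_Mapping.keys u. \<Sum>\<gamma>\<in>Poly_Mapping.keys v.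
     Poly_Mapping.single (\<alpha> + \<gamma>) (smul (\<mu> \<alpha> \<gamma>) (bracket (Poly_Mapping.lookup u \<alpha>) (Poly_Mapping.lookup v \<gamma>))))"
  by (simp add: loop_bracket_def torus_mult_basis tensor_single)

lemma loop_bracket_add_left: "loop_br (u + u') v = loop_br u v + loop_br u' v"
  unfolding loop_bracket_eq
  by (rule sum_keys_add) (simp add: bracket_add_left scale_right_distrib single_add sum.distrib)

lemma loop_bracket_add_right: "loop_br u (v + v') = loop_br u v + loop_br u v'"
  unfolding loop_bracket_eq sum.distrib[symmetric]
  by (intro sum.cong refl sum_keys_add) (simp add: bracket_add_right scale_right_distrib single_add)

lemma loop_bracket_single:
  "loop_br (Poly_Mapping.single \<alpha> x) (Poly_Mapping.single \<gamma> y)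
    = Poly_Mapping.single (\<alpha> + \<gamma>) (smul (\<mu> \<alpha> \<gamma>) (bracket x y))"
  unfolding loop_bracket_eq by (cases "x = 0"; cases "y = 0") (simp_all add: bracket_0)

lemma loop_form_eq:
  "loop_form form \<mu> u v = (\<Sum>\<alpha>\<in>Poly_Mapping.keys u. \<Sum>\<gamma>\<in>Poly_Mapping.keys v.
     form (Poly_Mapping.lookup u \<alpha>) (Poly_Mapping.lookup v \<gamma>) * (if \<alpha> = - \<gamma> then \<mu> \<alpha> \<gamma> else 0))"
  by (simp add: loop_form_def torus_form_basis)

lemma loop_form_add_left: "loop_form form \<mu> (u + u') v = loop_form form \<mu> u v + loop_form form \<mu> u' v"
  unfolding loop_form_eq by (rule sum_keys_add) (simp add: form_linear distrib_right sum.distrib)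

lemma loop_form_add_right: "loop_form form \<mu> u (v + v') = loop_form form \<mu> u v + loop_form form \<mu> u v'"
  unfolding loop_form_eq sum.distrib[symmetric]
  by (intro sum.cong refl sum_keys_add) (simp add: form_linear distrib_right)

lemma loop_form_single:
  "loop_form form \<mu> (Poly_Mapping.single \<alpha> x) (Poly_Mapping.single \<gamma> y)
    = form x y * (if \<alpha> = - \<gamma> then \<mu> \<alpha> \<gamma> else 0)"
  unfolding loop_form_eq by (cases "x = 0"; cases "y = 0") simp_all

lemma central_add_left: "central (u + u') v = central u v + central u' v"
  unfolding central_term_def
  by (rule sum_keys_add) (simp add: single_add loop_form_add_left complexification.scale_left_distrib)

lemma central_add_right: "central u (v + v') = central u v + central u v'"
  by (simp add: central_term_def loop_form_add_right complexification.scale_left_distrib sum.distrib)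

lemma central_single:
  "central (Poly_Mapping.single \<alpha> x) (Poly_Mapping.single \<gamma> y)
    = complexification_scale (form x y * (if \<alpha> = - \<gamma> then \<mu> \<alpha> \<gamma> else 0)) (lattice_embedding \<alpha>)"
  unfolding central_term_def loop_form_single[symmetric]
  by (rule sum_keys_single) (simp add: loop_form_eq)

lemma degree_action_add: "deg d (u + v) = deg d u + deg d v"
  unfolding degree_action_def by (rule sum_keys_add) (simp add: scale_right_distrib single_add)

lemma degree_action_single:
  "deg d (Poly_Mapping.single \<alpha> x) = Poly_Mapping.single \<alpha> (smul (dual_apply d (lattice_embedding \<alpha>)) x)"
  unfolding degree_action_def by (rule sum_keys_single) simp

text \<open>The degree derivations act diagonally, so identities between them can be checked one
  coefficient at a time.\<close>

lemma lookup_degree_action: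
  "Poly_Mapping.lookup (deg d u) \<alpha> = smul (dual_apply d (lattice_embedding \<alpha>)) (Poly_Mapping.lookup u \<alpha>)"
  by (induction u rule: poly_mapping_add_induct)
    (auto simp: degree_action_single degree_action_add lookup_add lookup_single when_def scale_right_distrib)

section \<open>Homogeneity and skew symmetry\<close>

lemma loop_bracket_scale_left: "loop_br (loop_scale c u) v = loop_scale c (loop_br u v)"
proof (induction u rule: poly_mapping_add_induct)
  case (single \<alpha> x)
  show ?case
    by (induction v rule: poly_mapping_add_induct)
      (simp_all add: loop_bracket_add_right loop_scale_add loop_scale_single loop_bracket_single
        bracket_scale_left mult.commute)
qed (simp add: loop_scale_add loop_bracket_add_left)

lemma loop_bracket_scale_right: "loop_br u (loop_scale c v) = loop_scale c (loop_br u v)"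
proof (induction u rule: poly_mapping_add_induct)
  case (single \<alpha> x)
  show ?case
    by (induction v rule: poly_mapping_add_induct)
      (simp_all add: loop_bracket_add_right loop_scale_add loop_scale_single loop_bracket_single
        bracket_scale_right mult.commute)
qed (simp add: loop_scale_add loop_bracket_add_left)

lemma central_scale_left: "central (loop_scale c u) v = complexification_scale c (central u v)"
proof (induction u rule: poly_mapping_add_induct)
  case (single \<alpha> x)
  show ?case
    by (induction v rule: poly_mapping_add_induct)
      (simp_all add: central_add_right loop_scale_single central_single form_linear
        complexification.scale_right_distrib mult.assoc)
qed (simp add: loop_scale_add central_add_left complexification.scale_right_distrib)

text \<open>Only opposite degrees contribute, and there the scalar is symmetric since both the form
  and \<mu> are. The sign comes from the lattice vector: it is \<alpha> on one side and its negative
  on the other.\<close>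

lemma central_skew: "central v u = - central u v"
proof (induction u rule: poly_mapping_add_induct)
  case (single \<alpha> x)
  show ?case
  proof (induction v rule: poly_mapping_add_induct)
    case (single \<gamma> y)
    show ?case
      by (auto simp: central_single form_commute[of y x] sym[of \<alpha>] complexification_tensor_uminus)
  qed (simp add: central_add_left central_add_right)
qed (simp add: central_add_left central_add_right)

lemma central_scale_right: "central u (loop_scale c v) = complexification_scale c (central u v)"
  by (metis central_skew central_scale_left complexification.scale_minus_right)

lemma central_self: "central u u = 0"
proof -
  \<comment> \<open>Doubling is written as a scalar multiplication, so that the complex vector space
    structure can cancel the 2.\<close>
  have "complexification_scale 2 (central u u) = central u u + central u u"
    using complexification.scale_left_distrib[of 1 1] by simp
  also have "\<dots> = 0"
    using central_skew[of u u] by (simp add: eq_neg_iff_add_eq_0)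
  finally show ?thesis by simp
qed

lemma loop_bracket_skew: "loop_br v u = - loop_br u v"
proof (induction u rule: poly_mapping_add_induct)
  case (single \<alpha> x)
  show ?case
    by (induction v rule: poly_mapping_add_induct)
      (simp_all add: loop_bracket_add_left loop_bracket_add_right loop_bracket_single
        bracket_skew[of _ x] sym[of \<alpha>] add.commute[of \<alpha>] single_uminus)
qed (simp add: loop_bracket_add_left loop_bracket_add_right)

text \<open>Homogeneous squares vanish already in the coefficients, and the cross terms of a sum
  cancel by skew symmetry.\<close>

lemma loop_bracket_self: "loop_br u u = 0"
proof (induction u rule: poly_mapping_add_induct)
  case (add u v)
  then show ?case
    using loop_bracket_skew[of u v] by (simp add: loop_bracket_add_left loop_bracket_add_right)
qed (simp add: loop_bracket_single bracket_self)

section \<open>The Jacobi identity, derivations, and the cyclic identity of the central term\<close>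

lemma cocycle_rotate: "\<mu> \<beta> \<gamma> * \<mu> \<alpha> (\<beta> + \<gamma>) = \<mu> \<gamma> \<alpha> * \<mu> \<beta> (\<gamma> + \<alpha>)"
  using cocycle[of \<beta> \<gamma> \<alpha>] by (simp add: sym[of \<alpha>])

lemma loop_jacobi:
  "loop_br u (loop_br v w) + loop_br v (loop_br w u) + loop_br w (loop_br u v) = 0"
proof (induction u rule: poly_mapping_add_induct)
  case (single \<alpha> x)
  show ?case
  proof (induction v rule: poly_mapping_add_induct)
    case (single \<beta> y)
    show ?case
    proof (induction w rule: poly_mapping_add_induct)
      case (single \<gamma> z)
      \<comment> \<open>The cocycle identity and the symmetry of \<mu> make the scalars of the three
        cyclic terms equal. Taking this common factor out leaves the Jacobi sum of the
        coefficients.\<close>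
      let ?K = "\<mu> \<beta> \<gamma> * \<mu> \<alpha> (\<beta> + \<gamma>)"
      have "\<mu> \<gamma> \<alpha> * \<mu> \<beta> (\<gamma> + \<alpha>) = ?K" "\<mu> \<alpha> \<beta> * \<mu> \<gamma> (\<alpha> + \<beta>) = ?K"
        by (metis cocycle_rotate)+
      then have "loop_br (Poly_Mapping.single \<alpha> x) (loop_br (Poly_Mapping.single \<beta> y) (Poly_Mapping.single \<gamma> z))
          + loop_br (Poly_Mapping.single \<beta> y) (loop_br (Poly_Mapping.single \<gamma> z) (Poly_Mapping.single \<alpha> x))
          + loop_br (Poly_Mapping.single \<gamma> z) (loop_br (Poly_Mapping.single \<alpha> x) (Poly_Mapping.single \<beta> y))
        = Poly_Mapping.single (\<alpha> + (\<beta> + \<gamma>))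
            (smul ?K (bracket x (bracket y z) + bracket y (bracket z x) + bracket z (bracket x y)))"
        by (simp add: loop_bracket_single bracket_scale_right mult.commute scale_right_distrib single_add add_ac)
      then show ?case by (simp add: jacobi)
    next
      case (add u v)
      show ?case
      \<comment> \<open>Adding the two induction hypotheses yields a single equation with the same
        summands as the expanded goal.\<close>
      using arg_cong2[OF add, of "(+)"] by (simp add: loop_bracket_add_left loop_bracket_add_right add_ac)
    qed
  next
    case (add u v)
    show ?case
      using arg_cong2[OF add, of "(+)"] by (simp add: loop_bracket_add_left loop_bracket_add_right add_ac)
  qed
next
  case (add u v)
  show ?case
      using arg_cong2[OF add, of "(+)"] by (simp add: loop_bracket_add_left loop_bracket_add_right add_ac)
qed

text \<open>The weight d(\<alpha>) is additive in \<alpha> and degrees add under the bracket, which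
  is the Leibniz rule.\<close>

lemma degree_action_bracket: "deg d (loop_br u v) = loop_br (deg d u) v + loop_br u (deg d v)"
proof (induction u rule: poly_mapping_add_induct)
  case (single \<alpha> x)
  show ?case
    by (induction v rule: poly_mapping_add_induct)
      (simp_all add: loop_bracket_add_right degree_action_add degree_action_single loop_bracket_single
        bracket_scale_right bracket_scale_left complexification_tensor_add dual_apply_add single_add[symmetric]
        scale_left_distrib[symmetric] algebra_simps del: scale_left_distrib scale_right_distrib)
qed (simp add: degree_action_add loop_bracket_add_left)

text \<open>In opposite degrees, one side gets its sign from the weight d(-\<alpha>) and the other
  from the lattice vector -\<alpha>. This matches the central parts in the Jacobi identity for one
  derivation and two loop elements.\<close>

lemma central_degree_action: "central u (deg d v) = central v (deg d u)"
proof (induction u rule: poly_mapping_add_induct)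
  case (single \<alpha> x)
  show ?case
  proof (induction v rule: poly_mapping_add_induct)
    case (single \<gamma> y)
    show ?case
      by (auto simp: central_single degree_action_single form_linear form_commute[of y x] sym[of \<alpha>]
          complexification_tensor_uminus dual_apply_uminus)
  qed (simp add: central_add_left central_add_right degree_action_add)
qed (simp add: central_add_left central_add_right degree_action_add)

text \<open>In homogeneous degrees all terms vanish unless the degrees sum to 0. By invariance of
  the form and the cocycle identity the three scalars agree, so the sum is that scalar times
  \<alpha> + \<beta> + \<gamma>, which is then 0.\<close>

lemma central_cyclic:
  "central u (loop_br v w) + central v (loop_br w u) + central w (loop_br u v) = 0"
proof (induction u rule: poly_mapping_add_induct)
  case (single \<alpha> x)
  show ?case
  proof (induction v rule: poly_mapping_add_induct)
    case (single \<beta> y)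
    show ?case
    proof (induction w rule: poly_mapping_add_induct)
      case (single \<gamma> z)
      have \<mu>: "\<mu> \<gamma> \<alpha> * \<mu> \<beta> (\<gamma> + \<alpha>) = \<mu> \<beta> \<gamma> * \<mu> \<alpha> (\<beta> + \<gamma>)" "\<mu> \<alpha> \<beta> * \<mu> \<gamma> (\<alpha> + \<beta>) = \<mu> \<beta> \<gamma> * \<mu> \<alpha> (\<beta> + \<gamma>)"
        by (metis cocycle_rotate)+
      have f: "form y (bracket z x) = form x (bracket y z)" "form z (bracket x y) = form x (bracket y z)"
        by (metis form_bracket form_commute)+
      \<comment> \<open>Stated for fresh variables because it is applied to all three cyclic
        orders.\<close>
      have eq: "central (Poly_Mapping.single \<alpha>' x') (loop_br (Poly_Mapping.single \<beta>' y') (Poly_Mapping.single \<gamma>' z'))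
          = complexification_scale (if \<alpha>' + \<beta>' + \<gamma>' = 0 then form x' (bracket y' z') * (\<mu> \<beta>' \<gamma>' * \<mu> \<alpha>' (\<beta>' + \<gamma>')) else 0)
              (lattice_embedding \<alpha>')" for \<alpha>' \<beta>' \<gamma>' x' y' z'
      proof -
        have "\<alpha>' = - (\<beta>' + \<gamma>') \<longleftrightarrow> \<alpha>' + \<beta>' + \<gamma>' = 0"
          by (simp only: eq_neg_iff_add_eq_0 add.assoc)
        then show ?thesis
          unfolding central_single loop_bracket_single form_linear by (simp add: mult_ac)
      qed
      \<comment> \<open>Makes the three support conditions literally equal, so that the common
        scalar can be factored out.\<close>
      have perm: "\<beta> + \<gamma> + \<alpha> = \<alpha> + \<beta> + \<gamma>" "\<gamma> + \<alpha> + \<beta> = \<alpha> + \<beta> + \<gamma>"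
        by (simp_all only: add_ac)
      show ?case
        unfolding eq perm \<mu> f complexification.scale_right_distrib[symmetric]
          complexification_tensor_add[symmetric]
        by (simp add: complexification_tensor_0)
    next
      case (add u v)
      show ?case
      using arg_cong2[OF add, of "(+)"]
      by (simp add: loop_bracket_add_left loop_bracket_add_right central_add_left central_add_right add_ac)
    qed
  next
    case (add u v)
    show ?case
      using arg_cong2[OF add, of "(+)"]
      by (simp add: loop_bracket_add_left loop_bracket_add_right central_add_left central_add_right add_ac)
  qed
next
  case (add u v)
  show ?case
      using arg_cong2[OF add, of "(+)"]
      by (simp add: loop_bracket_add_left loop_bracket_add_right central_add_left central_add_right add_ac)
qed

sublocale loop: lie_algebra loop_scale loop_br
proof
  show "loop_scale a (u + v) = loop_scale a u + loop_scale a v" for a and u v :: "'l \<Rightarrow>\<^sub>0 'g"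
    by (rule loop_scale_add)
  show "loop_scale (a + b) u = loop_scale a u + loop_scale b u" for a b and u :: "'l \<Rightarrow>\<^sub>0 'g"
    by (rule poly_mapping_eqI) (simp add: lookup_add scale_left_distrib)
  show "loop_scale a (loop_scale b u) = loop_scale (a * b) u" for a b and u :: "'l \<Rightarrow>\<^sub>0 'g"
    by (rule poly_mapping_eqI) simp
  show "loop_scale 1 u = u" for u :: "'l \<Rightarrow>\<^sub>0 'g"
    by (rule poly_mapping_eqI) simp
qed (fact loop_bracket_add_left loop_bracket_add_right loop_bracket_scale_left
    loop_bracket_scale_right loop_bracket_self loop_jacobi)+

section \<open>Assembling the Lie algebra on triples\<close>

lemma degree_action_scale: "deg d (loop_scale c u) = loop_scale c (deg d u)"
  by (rule poly_mapping_eqI) (simp add: lookup_degree_action mult.commute)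

lemma degree_action_dual_add: "deg (d + e) u = deg d u + deg e u"
  by (rule poly_mapping_eqI)
    (simp add: lookup_degree_action lookup_add plus_complexification_dual.rep_eq scale_left_distrib)

lemma degree_action_dual_scale: "deg (dual_scale c d) u = loop_scale c (deg d u)"
  by (rule poly_mapping_eqI) (simp add: lookup_degree_action dual_scale.rep_eq)

lemma degree_action_dual_zero: "deg 0 u = 0"
  by (rule poly_mapping_eqI) (simp add: lookup_degree_action zero_complexification_dual.rep_eq)

lemma degree_action_commute: "deg d (deg e u) = deg e (deg d u)"
  by (rule poly_mapping_eqI) (simp add: lookup_degree_action mult.commute)

lemma degree_action_diff: "deg d (u - v) = deg d u - deg d v"
  using degree_action_add[of d "u - v" v] by (simp add: algebra_simps)

lemma loop_bracket_diff_right: "loop_br u (v - w) = loop_br u v - loop_br u w"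
  using loop_bracket_add_right[of u "v - w" w] by (simp add: algebra_simps)

lemma central_diff_right: "central u (v - w) = central u v - central u w"
  using central_add_right[of u "v - w" w] by (simp add: algebra_simps)

lemma lhat_lie_algebra: "lie_algebra (lhat_scale smul) (lhat_bracket smul bracket form \<mu>)"
proof
  fix a b :: complex and X Y Z :: "('g, 'l) lhat"
  obtain u \<gamma> d where X: "X = (u, \<gamma>, d)" by (cases X)
  obtain v \<delta> e where Y: "Y = (v, \<delta>, e)" by (cases Y)
  obtain w \<epsilon> f where Z: "Z = (w, \<epsilon>, f)" by (cases Z)
  note L = X Y Z lhat_scale_def lhat_bracket_def
  note A = loop_bracket_add_left loop_bracket_add_right central_add_left central_add_right
    degree_action_add degree_action_dual_add
  note S = loop_bracket_scale_left loop_bracket_scale_right central_scale_left central_scale_right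
    degree_action_scale degree_action_dual_scale loop.scale_right_distrib loop.scale_right_diff_distrib
  show "lhat_scale smul a (X + Y) = lhat_scale smul a X + lhat_scale smul a Y"
    by (simp add: L dual_scale_simps loop.scale_right_distrib complexification.scale_right_distrib)
  show "lhat_scale smul (a + b) X = lhat_scale smul a X + lhat_scale smul b X"
    by (simp add: L dual_scale_simps loop.scale_left_distrib complexification.scale_left_distrib)
  show "lhat_scale smul a (lhat_scale smul b X) = lhat_scale smul (a * b) X"
    by (simp add: L dual_scale_simps)
  show "lhat_scale smul 1 X = X"
    by (simp add: L dual_scale_simps)
  show "lhat_bracket smul bracket form \<mu> (X + Y) Z
      = lhat_bracket smul bracket form \<mu> X Z + lhat_bracket smul bracket form \<mu> Y Z"
    by (simp add: L A)
  show "lhat_bracket smul bracket form \<mu> X (Y + Z)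
      = lhat_bracket smul bracket form \<mu> X Y + lhat_bracket smul bracket form \<mu> X Z"
    by (simp add: L A)
  show "lhat_bracket smul bracket form \<mu> (lhat_scale smul a X) Y
      = lhat_scale smul a (lhat_bracket smul bracket form \<mu> X Y)"
    by (simp add: L S dual_scale_simps)
  show "lhat_bracket smul bracket form \<mu> X (lhat_scale smul a Y)
      = lhat_scale smul a (lhat_bracket smul bracket form \<mu> X Y)"
    by (simp add: L S dual_scale_simps)
  show "lhat_bracket smul bracket form \<mu> X X = 0"
    by (simp add: L loop_bracket_self central_self zero_prod_def)
  have "loop_br u (loop_br v w) + loop_br v (loop_br w u) = - loop_br w (loop_br u v)"
    "central u (loop_br v w) + central v (loop_br w u) = - central w (loop_br u v)"
    using loop_jacobi[of u v w] central_cyclic[of u v w] by (simp_all only: eq_neg_iff_add_eq_0)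
  \<comment> \<open>Solved for the term with u outermost, the cyclic identities serve as rewrite
    rules.\<close>
  then have *: "loop_br u (loop_br v w) = - loop_br w (loop_br u v) - loop_br v (loop_br w u)"
    "central u (loop_br v w) = - central w (loop_br u v) - central v (loop_br w u)"
    by (simp_all only: eq_diff_eq)
  show "lhat_bracket smul bracket form \<mu> X (lhat_bracket smul bracket form \<mu> Y Z)
      + lhat_bracket smul bracket form \<mu> Y (lhat_bracket smul bracket form \<mu> Z X)
      + lhat_bracket smul bracket form \<mu> Z (lhat_bracket smul bracket form \<mu> X Y) = 0"
    \<comment> \<open>The explicit instances fix a normal form: derivations are nested in the order
      d, e, f, and the differentiated element moves to the second argument of the loop bracket. The
      mixed terms then cancel.\<close>
    by (simp add: L * A loop_bracket_diff_right central_diff_right degree_action_diff degree_action_bracket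
        degree_action_dual_zero degree_action_commute[of e d] degree_action_commute[of f d]
        degree_action_commute[of f e] central_degree_action[of u e w] central_degree_action[of u f v]
        central_degree_action[of v d w] loop_bracket_skew[of "deg e w" u] loop_bracket_skew[of "deg f v" u]
        loop_bracket_skew[of "deg f u" v] loop_bracket_skew[of "deg d w" v] loop_bracket_skew[of "deg d v" w]
        loop_bracket_skew[of "deg e u" w] zero_prod_def)
qed

end

section \<open>The lifted automorphism\<close>

definition loop_map ::
  "(complex \<Rightarrow> 'g::ab_group_add \<Rightarrow> 'g) \<Rightarrow> ('g \<Rightarrow> 'g) \<Rightarrow> ('l::ab_group_add \<Rightarrow>\<^sub>0 'g) \<Rightarrow> ('l \<Rightarrow>\<^sub>0 'g)" where
  "loop_map smul \<tau> u =
     (\<Sum>\<alpha>\<in>Poly_Mapping.keys u. tensor smul (\<tau> (Poly_Mapping.lookup u \<alpha>)) (torus_basis (- \<alpha>)))"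

lemma tau_bar_eq: "tau_bar smul \<tau> (u, \<gamma>, d) = (loop_map smul \<tau> u, - \<gamma>, - d)"
  by (simp add: tau_bar_def loop_map_def)

text \<open>Preservation of the form is an assumption here; the main theorem supplies it from the
  invariance of the Killing form.\<close>

locale affine_isometry = affinization smul bracket form \<mu>
  for smul :: "complex \<Rightarrow> 'g::ab_group_add \<Rightarrow> 'g" and bracket form
    and \<mu> :: "'l::ab_group_add \<Rightarrow> 'l \<Rightarrow> complex" +
  fixes \<tau> :: "'g \<Rightarrow> 'g"
  assumes linear: "Vector_Spaces.linear smul smul \<tau>"
    and bracket: "\<tau> (bracket x y) = bracket (\<tau> x) (\<tau> y)"
    and isometry: "form (\<tau> x) (\<tau> y) = form x y"
begin

sublocale \<tau>: Vector_Spaces.linear smul smul \<tau>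
  by (fact linear)

section \<open>The action on the loop part and its compatibility with the bracket\<close>

abbreviation "\<theta> \<equiv> loop_map smul \<tau>"

lemma loop_map_eq: "\<theta> u = (\<Sum>\<alpha>\<in>Poly_Mapping.keys u. Poly_Mapping.single (- \<alpha>) (\<tau> (Poly_Mapping.lookup u \<alpha>)))"
  by (simp add: loop_map_def torus_basis_def tensor_single)

lemma loop_map_add: "\<theta> (u + v) = \<theta> u + \<theta> v"
  unfolding loop_map_eq by (rule sum_keys_add) (simp add: \<tau>.add single_add)

lemma loop_map_single: "\<theta> (Poly_Mapping.single \<alpha> x) = Poly_Mapping.single (- \<alpha>) (\<tau> x)"
  unfolding loop_map_eq by (rule sum_keys_single) simp

lemma loop_map_diff: "\<theta> (u - v) = \<theta> u - \<theta> v"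
  using loop_map_add[of "u - v" v] by (simp add: algebra_simps)

lemma lookup_loop_map: "Poly_Mapping.lookup (\<theta> u) \<alpha> = \<tau> (Poly_Mapping.lookup u (- \<alpha>))"
  by (induction u rule: poly_mapping_add_induct)
    (auto simp: loop_map_single loop_map_add lookup_add lookup_single when_def \<tau>.add)

lemma loop_map_scale: "\<theta> (loop_scale c u) = loop_scale c (\<theta> u)"
  by (rule poly_mapping_eqI) (simp add: lookup_loop_map \<tau>.scale)

lemma loop_map_bracket: "\<theta> (loop_br u v) = loop_br (\<theta> u) (\<theta> v)"
proof (induction u rule: poly_mapping_add_induct)
  case (single \<alpha> x)
  show ?case
    by (induction v rule: poly_mapping_add_induct)
      (simp_all add: loop_bracket_add_right loop_map_add loop_map_single loop_bracket_single
        \<tau>.scale bracket uminus[symmetric] add.commute)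
qed (simp add: loop_bracket_add_left loop_map_add)

text \<open>In opposite degrees, reversal swaps the two arguments of \<mu>, so its symmetry and the
  isometry keep the scalar, while the lattice vector changes sign. This agrees with the action by -1
  on the centre \<V>.\<close>

lemma central_loop_map: "central (\<theta> u) (\<theta> v) = - central u v"
proof (induction u rule: poly_mapping_add_induct)
  case (single \<alpha> x)
  show ?case
  proof (induction v rule: poly_mapping_add_induct)
    case (single \<gamma> y)
    show ?case
      by (auto simp: loop_map_single central_single isometry complexification_tensor_uminus sym[of \<gamma>])
  qed (simp add: central_add_right loop_map_add)
qed (simp add: central_add_left loop_map_add)

text \<open>The sign of -d cancels the sign from the reversed degree.\<close>

lemma degree_action_loop_map: "deg (- d) (\<theta> u) = \<theta> (deg d u)"
  by (rule poly_mapping_eqI)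
    (simp add: lookup_degree_action lookup_loop_map uminus_complexification_dual.rep_eq \<tau>.scale \<tau>.neg
      complexification_tensor_uminus dual_apply_uminus)

lemma tau_bar_bracket:
  "tau_bar smul \<tau> (lhat_bracket smul bracket form \<mu> X Y)
    = lhat_bracket smul bracket form \<mu> (tau_bar smul \<tau> X) (tau_bar smul \<tau> Y)"
  by (cases X; cases Y) (simp add: lhat_bracket_def tau_bar_eq loop_map_bracket loop_map_add loop_map_diff
      central_loop_map degree_action_loop_map)

lemma tau_bar_linear:
  "Vector_Spaces.linear (lhat_scale smul) (lhat_scale smul) (tau_bar smul \<tau> :: ('g, 'l) lhat \<Rightarrow> _)"
proof -
  interpret lhat: lie_algebra "lhat_scale smul" "lhat_bracket smul bracket form \<mu>"
    by (rule lhat_lie_algebra)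
  show ?thesis
    unfolding Vector_Spaces.linear_iff
  proof (intro conjI allI lhat.vector_space_axioms)
    fix X Y :: "('g, 'l) lhat" and c
    show "tau_bar smul \<tau> (X + Y) = tau_bar smul \<tau> X + tau_bar smul \<tau> Y"
      by (cases X; cases Y) (simp add: tau_bar_eq loop_map_add)
    show "tau_bar smul \<tau> (lhat_scale smul c X) = lhat_scale smul c (tau_bar smul \<tau> X)"
      by (cases X) (simp add: tau_bar_eq lhat_scale_def loop_map_scale dual_scale_simps)
  qed
qed

text \<open>Doubling n makes the exponent even, so degrees and the signs on the other two components
  are restored; the coefficients see only an even power of \<tau>.\<close>

lemma tau_bar_funpow:
  assumes "\<tau> ^^ n = id"
  shows "(tau_bar smul \<tau> :: ('g, 'l) lhat \<Rightarrow> _) ^^ (2 * n) = id"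
proof
  fix X :: "('g, 'l) lhat"
  have lookup: "Poly_Mapping.lookup ((\<theta> ^^ (2 * k)) u) \<alpha> = (\<tau> ^^ (2 * k)) (Poly_Mapping.lookup u \<alpha>)"
    for k u and \<alpha> :: 'l
    by (induction k) (simp_all add: lookup_loop_map)
  have pow: "(tau_bar smul \<tau> ^^ (2 * k)) (u, \<gamma>, d) = ((\<theta> ^^ (2 * k)) u, \<gamma>, d)"
    for k u and \<gamma> :: "'l complexification" and d
    by (induction k) (simp_all add: tau_bar_eq)
  have "\<tau> ^^ (2 * n) = id"
    using assms by (simp add: mult_2 funpow_add)
  then have "(\<theta> ^^ (2 * n)) u = u" for u :: "'l \<Rightarrow>\<^sub>0 'g"
    by (intro poly_mapping_eqI) (simp add: lookup)
  then show "(tau_bar smul \<tau> ^^ (2 * n)) X = id X"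
    by (cases X) (simp add: pow)
qed

lemma chevalley_tau_bar:
  assumes n: "n > 0" "\<tau> ^^ n = id" and H: "\<And>x. x \<in> H \<Longrightarrow> \<tau> x = - x"
  shows "chevalley_automorphism (lhat_scale smul) (lhat_bracket smul bracket form \<mu>)
    (lhat_cartan smul H) (tau_bar smul \<tau>)"
proof -
  let ?T = "tau_bar smul \<tau> :: ('g, 'l) lhat \<Rightarrow> _"
  have pow: "?T ^^ (2 * n) = id"
    by (rule tau_bar_funpow) fact
  \<comment> \<open>Finite order gives bijectivity: the power with exponent m is a two-sided
    inverse.\<close>
  obtain m where m: "2 * n = Suc m"
    using n(1) by (cases "2 * n") auto
  have "?T \<circ> ?T ^^ m = id"
    using pow by (simp only: m funpow.simps(2))
  moreover have "?T ^^ m \<circ> ?T = id"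
    using pow by (simp only: m funpow_Suc_right)
  ultimately have "bij ?T"
    using o_bij by blast
  moreover have "?T X = - X" if X: "X \<in> lhat_cartan smul H" for X :: "('g, 'l) lhat"
  proof -
    obtain x \<gamma> d where x: "x \<in> H" "X = (tensor smul x (torus_basis 0), \<gamma>, d)"
      using X by (auto simp: lhat_cartan_def)
    \<comment> \<open>Degree 0 is fixed by the reversal, so only the sign from \<tau> on
      \<open>H\<close> remains.\<close>
    then have "?T X = (tensor smul (- x) (torus_basis 0), - \<gamma>, - d)"
      using tau_bar_tensor[OF linear, of x 0 \<gamma> d] H by simp
    then show ?thesis
      unfolding x torus_basis_def tensor_single by (simp add: single_uminus)
  qed
  moreover have "\<exists>n>0. ?T ^^ n = id"
    using pow n(1) by (intro exI[of _ "2 * n"]) simp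
  ultimately show ?thesis
    unfolding chevalley_automorphism_def lie_automorphism_def
    by (simp add: lhat_lie_algebra tau_bar_linear tau_bar_bracket)
qed

end

theorem corollary3p27:
  fixes smul :: "complex \<Rightarrow> 'g::ab_group_add \<Rightarrow> 'g"
    and bracket :: "'g \<Rightarrow> 'g \<Rightarrow> 'g"
    and form :: "'g \<Rightarrow> 'g \<Rightarrow> complex"
    and \<hh> :: "'g set"
    and \<tau> :: "'g \<Rightarrow> 'g"
    and \<mu> :: "'l::ab_group_add \<Rightarrow> 'l \<Rightarrow> complex"
  assumes "simple_lie_algebra smul bracket"
    and "lie_algebra.cartan_subalgebra smul bracket \<hh>"
    and "lie_algebra.nondegenerate_invariant_form smul bracket form"
    and "\<exists>c. c \<noteq> 0 \<and> (\<forall>x y. form x y = c * lie_algebra.killing_form smul bracket x y)"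
    and "chevalley_automorphism smul bracket \<hh> \<tau>"
    and "quantum_torus \<mu>"
  shows "chevalley_automorphism (lhat_scale smul) (lhat_bracket smul bracket form \<mu>)
           (lhat_cartan smul \<hh>) (tau_bar smul \<tau>) \<and>
         chevalley_automorphism (lhat_scale smul)
           (lhat_bracket smul bracket form (laurent_cocycle :: int ^ 'n \<Rightarrow> int ^ 'n \<Rightarrow> complex))
           (lhat_cartan smul \<hh>) (tau_bar smul \<tau>)"
proof -
  interpret simple_lie_algebra smul bracket by fact
  have auto: "lie_automorphism smul bracket \<tau>" and H: "\<And>x. x \<in> \<hh> \<Longrightarrow> \<tau> x = - x"
    using assms(5) by (auto simp: chevalley_automorphism_def)
  obtain n where n: "n > 0" "\<tau> ^^ n = id"
    using assms(5) by (auto simp: chevalley_automorphism_def)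
  \<comment> \<open>The form is a constant multiple of the Killing form, so it inherits the
    invariance.\<close>
  have iso: "form (\<tau> x) (\<tau> y) = form x y" for x y
    using assms(4) killing_form_automorphism[OF auto] by metis
  have \<tau>: "Vector_Spaces.linear smul smul \<tau>" "\<tau> (bracket x y) = bracket (\<tau> x) (\<tau> y)" for x y
    using auto by (auto simp: lie_automorphism_def)
  interpret quantum_torus \<mu> by fact
  interpret \<tau>: Vector_Spaces.linear smul smul \<tau> by fact
  interpret q: affine_isometry smul bracket form \<mu> \<tau>
    by unfold_locales (fact assms(3) cocycle sym uminus \<tau> iso)+
  \<comment> \<open>The Laurent case lives on a different lattice and is a second instance; for the
    constant cocycle 1 the conditions on \<mu> are immediate.\<close>
  interpret l: affine_isometry smul bracket form "laurent_cocycle :: int ^ 'n \<Rightarrow> int ^ 'n \<Rightarrow> complex" \<tau>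
    by unfold_locales (simp add: laurent_cocycle_def | fact assms(3) \<tau> iso)+
  show ?thesis
    using q.chevalley_tau_bar l.chevalley_tau_bar n H by blast
qed

end
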